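(* Let $q>1/2$, $\gamma>0$, and let the $\star$-norm (with weights $\{h_j\}$) satisfy $$\limsup_{j\to+\infty}\frac{(\log(1+\langle j\rangle))^{\sigma}}{h_j}<+\infty\qquad\text{for some }\sigma>2 .$$ Then, for any $\mu_1>1+q$ and $\mu_2>1$, one has $\mathcal D_{\gamma,\mu_1,\mu_2}\subseteq\mathfrak B^\star$. Moreover there exists a sequence $\beta_*=\{\beta_*(m)\}_{m\in\mathbb N}$, depending only on $\gamma,\mu_1,\mu_2$ and $\sigma$, such that, for all $\omega\in\mathcal D_{\gamma,\mu_1,\mu_2}$, one has $\beta^\star_\omega(m)\ge\beta_*(m)$ for all $m\in\mathbb N$; in particular, the $\star$-Bryuno function is bounded uniformly, for $\omega\in\mathcal D_{\gamma,\mu_1,\mu_2}$, as $$\mathcal B^\star(\omega)\le\mathcal B_*:=\sum_{m\ge1}\frac1{2^m}\log\frac1{\beta_*(m)}<+\infty .$$ More generally, for any sequence $\beta=\{\beta(m)\}_{m\in\mathbb N}$ of positive numbers such that $$\beta(m)\le\beta_*(m)\quad\forall m\ge1,\qquad \mathcal B:=\sum_{m\ge1}\frac1{2^m}\log\frac1{\beta(m)}<+\infty,$$ there exists a set $\mathcal D\subseteq\mathfrak B^\star$ such that $\mathcal D_{\gamma,\mu_1,\mu_2}\subseteq\mathcal D$ and $\mathcal B^\star(\omega)\le\mathcal B$ for all $\omega\in\mathcal D$.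
   Context: Notation: $\langle j\rangle=\max\{1,|j|\}$; $\|\cdot\|_1$ is the $\ell^1$ norm; $a\cdot b=\sum_{j\in\mathbb Z}a_jb_j$. $\mathbb Z^{\mathbb Z}_f=\{\nu\in\mathbb Z^{\mathbb Z}:\|\nu\|_1<\infty\}$. $\star$-norm: $|\nu|_\star=\sum_{j\in\mathbb Z}h_j|\nu_j|$ for $\nu\in\mathbb Z^{\mathbb Z}_f$, where the weights $h_j$ (fixed once and for all) are positive reals with $h_{-j}=h_j$, $h_{j+1}\ge h_j$ for $j\ge0$, and $h_j\to+\infty$ as $j\to+\infty$. For $\omega\in\mathbb R^{\mathbb Z}$ set $\beta^\star_\omega(m)=\inf\{|\omega\cdot\nu|:\nu\in\mathbb Z^{\mathbb Z}_f,\ 0<|\nu|_\star\le2^m\}$ (equal to $+\infty$ if the index set is empty), $\mathcal B^\star(\omega)=\sum_{m\ge1}2^{-m}\log(1/\beta^\star_\omega(m))$ (the finitely many terms, if any, with empty index set are disregarded), and $\mathfrak B^\star=\{\omega\in\mathbb R^{\mathbb Z}:\mathcal B^\star(\omega)<+\infty\}$. Diophantine set: $\mathcal D_{\gamma,\mu_1,\mu_2}=\bigl\{\omega\in\mathbb R^{\mathbb Z}:|\omega\cdot\nu|\ge\gamma\prod_{j\in\mathbb Z}(1+\langle j\rangle^{\mu_1}|\nu_j|^{\mu_2})^{-1}\ \ \forall\nu\in\mathbb Z^{\mathbb Z}_f\setminus\{0\}\bigr\}$. *)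

theory Defs
  imports "HOL-Analysis.Analysis"
begin

text \<open>Integer sequences indexed by the integers with finite \<open>\<ell>\<^sup>1\<close> norm.\<close>

definition ZZf :: "(int \<Rightarrow> int) set" where
  "ZZf = {\<nu>. (\<lambda>j. real_of_int \<bar>\<nu> j\<bar>) summable_on UNIV}"

lemma ZZf_iff_finite_support: "\<nu> \<in> ZZf \<longleftrightarrow> finite {j. \<nu> j \<noteq> 0}"
proof
  assume "\<nu> \<in> ZZf"
  then have s: "(\<lambda>j. real_of_int \<bar>\<nu> j\<bar>) summable_on UNIV"
    by (simp add: ZZf_def)
  have "((\<lambda>j. real_of_int \<bar>\<nu> j\<bar>) has_sum (\<Sum>\<^sub>\<infinity>j. real_of_int \<bar>\<nu> j\<bar>)) UNIV"
    using s by (rule has_sum_infsum)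
  have bound: "real (card F) \<le> (\<Sum>\<^sub>\<infinity>j. real_of_int \<bar>\<nu> j\<bar>)"
    if "finite F" "F \<subseteq> {j. \<nu> j \<noteq> 0}" for F
  proof -
    have "real (card F) = (\<Sum>j\<in>F. 1)" by simp
    also have "\<dots> \<le> (\<Sum>j\<in>F. real_of_int \<bar>\<nu> j\<bar>)"
      using that by (intro sum_mono) auto
    also have "\<dots> \<le> (\<Sum>\<^sub>\<infinity>j. real_of_int \<bar>\<nu> j\<bar>)"
      by (rule finite_sum_le_infsum[OF s]) (use that in auto)
    finally show ?thesis .
  qed
  show "finite {j. \<nu> j \<noteq> 0}"
  proof (rule ccontr)
    assume inf: "infinite {j. \<nu> j \<noteq> 0}"
    obtain n :: nat where n: "(\<Sum>\<^sub>\<infinity>j. real_of_int \<bar>\<nu> j\<bar>) < real n"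
      using reals_Archimedean2 by blast
    obtain F where "finite F" "card F = n" "F \<subseteq> {j. \<nu> j \<noteq> 0}"
      using infinite_arbitrarily_large[OF inf] by blast
    then show False using bound n by force
  qed
next
  assume "finite {j. \<nu> j \<noteq> 0}"
  then have "(\<lambda>j. real_of_int \<bar>\<nu> j\<bar>) summable_on {j. \<nu> j \<noteq> 0}"
    by (rule summable_on_finite)
  also have "?this \<longleftrightarrow> (\<lambda>j. real_of_int \<bar>\<nu> j\<bar>) summable_on UNIV"
    by (rule summable_on_cong_neutral) auto
  finally show "\<nu> \<in> ZZf"
    by (simp add: ZZf_def)
qed

definition dotZ :: "(int \<Rightarrow> real) \<Rightarrow> (int \<Rightarrow> int) \<Rightarrow> real" where
  "dotZ \<omega> \<nu> = (\<Sum>\<^sub>\<infinity>j. \<omega> j * real_of_int (\<nu> j))"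

definition jbracket :: "int \<Rightarrow> real" where
  "jbracket j = real_of_int (max 1 \<bar>j\<bar>)"

definition star_weights :: "(int \<Rightarrow> real) \<Rightarrow> bool" where
  "star_weights h \<longleftrightarrow>
     (\<forall>j. 0 < h j) \<and> (\<forall>j. h (- j) = h j) \<and> (\<forall>j\<ge>0. h j \<le> h (j + 1)) \<and>
     filterlim h at_top at_top"

definition star_norm :: "(int \<Rightarrow> real) \<Rightarrow> (int \<Rightarrow> int) \<Rightarrow> real" where
  "star_norm h \<nu> = (\<Sum>\<^sub>\<infinity>j. h j * real_of_int \<bar>\<nu> j\<bar>)"

text \<open>The infimum is taken in the extended reals, so it is \<open>\<infinity>\<close> exactly when the
  index set is empty.\<close>

definition beta_star :: "(int \<Rightarrow> real) \<Rightarrow> (int \<Rightarrow> real) \<Rightarrow> nat \<Rightarrow> ereal" where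
  "beta_star h \<omega> m =
     (INF \<nu> \<in> {\<nu> \<in> ZZf. 0 < star_norm h \<nu> \<and> star_norm h \<nu> \<le> 2 ^ m}. ereal \<bar>dotZ \<omega> \<nu>\<bar>)"

text \<open>The function \<open>x \<mapsto> log (1 / x)\<close> for \<open>x \<ge> 0\<close>, with value \<open>\<infinity>\<close> at \<open>0\<close>.  The value \<open>0\<close>
  at \<open>\<infinity>\<close> implements the convention that the terms of the Bryuno series with empty index
  set are disregarded.\<close>

definition log_recip :: "ereal \<Rightarrow> ereal" where
  "log_recip x =
     (if x = \<infinity> then 0 else if x = 0 then \<infinity> else ereal (ln (1 / real_of_ereal x)))"

text \<open>The sum over \<open>m \<ge> 1\<close>, with value in the extended reals.\<close>

definition bryuno :: "(int \<Rightarrow> real) \<Rightarrow> (int \<Rightarrow> real) \<Rightarrow> ereal" where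
  "bryuno h \<omega> = (\<Sum>m. ereal (1 / 2 ^ Suc m) * log_recip (beta_star h \<omega> (Suc m)))"

text \<open>The terms need not be nonnegative, but the partial sums always converge in the
  extended reals.\<close>

lemma beta_star_antimono: "m \<le> n \<Longrightarrow> beta_star h \<omega> n \<le> beta_star h \<omega> m"
  unfolding beta_star_def
  by (intro INF_superset_mono) (auto intro: order_trans[OF _ power_increasing])

lemma beta_star_nonneg: "0 \<le> beta_star h \<omega> m"
  unfolding beta_star_def by (intro INF_greatest) auto

lemma bryuno_sums:
  "(\<lambda>m. ereal (1 / 2 ^ Suc m) * log_recip (beta_star h \<omega> (Suc m))) sums bryuno h \<omega>"
proof -
  let ?b = "\<lambda>m. beta_star h \<omega> (Suc m)"
  let ?t = "\<lambda>m. ereal (1 / 2 ^ Suc m) * log_recip (?b m)"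
  obtain L :: real where L: "0 \<le> L" "\<And>m. - ereal L \<le> log_recip (?b m)"
  proof (cases "\<exists>m. ?b m \<noteq> \<infinity>")
    case False
    then show thesis by (intro that[of 0]) (auto simp: log_recip_def)
  next
    case True
    define k where "k = (LEAST m. ?b m \<noteq> \<infinity>)"
    have k: "?b k \<noteq> \<infinity>" unfolding k_def using True by (rule LeastI_ex)
    have below: "?b m = \<infinity>" if "m < k" for m
      using not_less_Least[of m "\<lambda>m. ?b m \<noteq> \<infinity>"] that unfolding k_def by blast
    obtain B where B: "?b k = ereal B" "0 \<le> B"
      using k beta_star_nonneg[of h \<omega> "Suc k"] by (cases "?b k") auto
    show thesis
    proof (rule that[of "ln (max 1 B)"])
      show "0 \<le> ln (max 1 B)" by simp
      fix m
      show "- ereal (ln (max 1 B)) \<le> log_recip (?b m)"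
      proof (cases "m < k")
        case True
        then show ?thesis by (simp add: below log_recip_def)
      next
        case False
        then have "?b m \<le> ereal B"
          using beta_star_antimono[of "Suc k" "Suc m" h \<omega>] B by simp
        then obtain x where x: "?b m = ereal x" "0 \<le> x" "x \<le> B"
          using beta_star_nonneg[of h \<omega> "Suc m"] by (cases "?b m") auto
        show ?thesis
        proof (cases "x = 0")
          case True
          then show ?thesis using x by (simp add: log_recip_def)
        next
          case False
          then have "ln x \<le> ln (max 1 B)" using x by (subst ln_le_cancel_iff) auto
          then show ?thesis using x False
            by (simp add: log_recip_def zero_ereal_def ln_div)
        qed
      qed
    qed
  qed
  let ?c = "\<lambda>m. ereal (1 / 2 ^ Suc m * L)"
  have nonneg: "0 \<le> ?t m + ?c m" for m
  proof -
    have "ereal (1 / 2 ^ Suc m) * (- ereal L) \<le> ?t m"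
      by (rule ereal_mult_left_mono[OF L(2)]) simp
    then have "- ?c m \<le> ?t m" by simp
    then show ?thesis by (cases "?t m") auto
  qed
  have c: "(\<lambda>m. 1 / 2 ^ Suc m * L) sums L"
    using sums_mult2[OF power_half_series, of L] by (simp add: power_divide)
  have "(\<lambda>m. ?t m + ?c m) sums (\<Sum>m. ?t m + ?c m)"
    using nonneg by (intro summable_sums summable_ereal_pos)
  moreover have "(\<lambda>m. - ?c m) sums (- ereal L)"
    using sums_minus[OF c] by (simp flip: sums_ereal)
  moreover have "(\<Sum>m. ?t m + ?c m) \<noteq> - \<infinity>"
    using suminf_nonneg[OF summable_ereal_pos, of "\<lambda>m. ?t m + ?c m"] nonneg by auto
  ultimately have "(\<lambda>m. (?t m + ?c m) + - ?c m) sums ((\<Sum>m. ?t m + ?c m) + - ereal L)"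
    unfolding sums_def sum.distrib by (intro tendsto_add_ereal_general) auto
  moreover have "(?t m + ?c m) + - ?c m = ?t m" for m
    by (cases "?t m") auto
  ultimately show ?thesis
    unfolding bryuno_def by (simp add: sums_iff)
qed

definition Bryuno_set :: "(int \<Rightarrow> real) \<Rightarrow> (int \<Rightarrow> real) set" where
  "Bryuno_set h = {\<omega>. bryuno h \<omega> < \<infinity>}"

text \<open>The product over all integers reduces to the (finite) support of \<open>\<nu>\<close>, since every
  other factor equals \<open>1\<close>.\<close>

definition Dioph :: "real \<Rightarrow> real \<Rightarrow> real \<Rightarrow> (int \<Rightarrow> real) set" where
  "Dioph \<gamma> \<mu>\<^sub>1 \<mu>\<^sub>2 =
     {\<omega>. \<forall>\<nu> \<in> ZZf - {\<lambda>_. 0}.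
        \<bar>dotZ \<omega> \<nu>\<bar> \<ge>
          \<gamma> * (\<Prod>j | \<nu> j \<noteq> 0.
                 inverse (1 + jbracket j powr \<mu>\<^sub>1 * real_of_int \<bar>\<nu> j\<bar> powr \<mu>\<^sub>2))}"

end

theory Submission
  imports Defs "HOL-Real_Asymp.Real_Asymp"
begin

text \<open>
  Taking logarithms, the Diophantine condition bounds \<open>\<bar>\<omega> \<cdot> \<nu>\<bar>\<close> below by
  \<open>\<gamma> exp (- \<Sum>\<^sub>j ln (1 + \<langle>j\<rangle>\<^bsup>\<mu>\<^sub>1\<^esup> \<bar>\<nu>\<^sub>j\<bar>\<^bsup>\<mu>\<^sub>2\<^esup>))\<close>, so everything rests on an upper
  bound \<open>F m\<close> for this sum, valid for all \<open>\<nu>\<close> with \<open>\<bar>\<nu>\<bar>\<^sub>\<star> \<le> 2\<^sup>m\<close>, such that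
  \<open>\<Sum>\<^sub>m 2\<^bsup>-m\<^esup> F m\<close> converges.

  Each summand is at most \<open>2\<mu>\<^sub>1 ln (1 + \<langle>j\<rangle>) + \<mu>\<^sub>2 ln \<bar>\<nu>\<^sub>j\<bar>\<close>.  The support of \<open>\<nu>\<close> is cut
  at \<open>\<bar>j\<bar> = 2\<^bsup>m div 2\<^esup>\<close>.  Below the cut there are \<open>O(2\<^bsup>m/2\<^esup>)\<close> indices, each with a summand
  \<open>O(m + 1)\<close>, because \<open>\<bar>\<nu>\<^sub>j\<bar> \<le> 2\<^sup>m / h\<^sub>0\<close>.  Above the cut \<open>ln (1 + \<langle>j\<rangle>)\<close> is at least a
  fixed multiple of \<open>m + 1\<close>.  There the summand is \<open>O(ln (1 + \<langle>j\<rangle>) \<bar>\<nu>\<^sub>j\<bar>)\<close>, the growth of the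
  weights gives
  \<open>ln (1 + \<langle>j\<rangle>) \<bar>\<nu>\<^sub>j\<bar> = O((m+1)\<^bsup>1-\<sigma>\<^esup> h\<^sub>j \<bar>\<nu>\<^sub>j\<bar>)\<close>, and summing over \<open>j\<close> costs
  only \<open>O((m+1)\<^bsup>1-\<sigma>\<^esup> 2\<^sup>m)\<close> (lemma \<open>sum_log_factors_le\<close>).  After multiplication by \<open>2\<^bsup>-m\<^esup>\<close> the first
  contribution decays geometrically, and the second is the series \<open>\<Sum> (m+1)\<^bsup>1-\<sigma>\<^esup>\<close>, which
  converges because \<open>\<sigma> > 2\<close> (lemma \<open>summable_log_bound\<close>).

  Hence \<open>\<beta>\<^sub>*(m) = min 1 \<gamma> \<cdot> exp (- F m)\<close> is a lower bound for \<open>\<beta>\<^sup>\<star>\<^sub>\<omega>(m)\<close> uniform in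
  \<open>\<omega>\<close>.  Capping it at \<open>1\<close> makes all \<open>log (1 / \<beta>\<^sub>*(m))\<close> nonnegative, so that the disregarded
  terms of the Bryuno series are dominated as well; the same holds for every \<open>\<beta> \<le> \<beta>\<^sub>*\<close>, and
  therefore the Diophantine set itself serves as the set \<open>\<D>\<close> of the last claim.
\<close>

section \<open>The weights\<close>

lemma jbracket_ge_1: "1 \<le> jbracket j"
  by (simp add: jbracket_def)

lemma star_weights_ge_0:
  assumes "star_weights h"
  shows "h 0 \<le> h j"
proof -
  have nonneg: "h 0 \<le> h (int n)" for n
  proof (induction n)
    case (Suc n)
    have "h (int n) \<le> h (int n + 1)"
      using assms by (simp add: star_weights_def)
    with Suc show ?case by (simp add: add.commute)
  qed simp
  have "h j = h \<bar>j\<bar>"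
    using assms by (auto simp: star_weights_def abs_if)
  with nonneg[of "nat \<bar>j\<bar>"] show ?thesis by simp
qed

text \<open>The limsup controls only large positive indices.  The remaining ones are covered by
  evenness, and by the fact that finitely many weights, being at least \<open>h 0 > 0\<close>, can be
  absorbed into the constant.\<close>

lemma weights_dominate_log:
  assumes h: "star_weights h"
    and lim: "Limsup at_top (\<lambda>j. ereal (ln (1 + jbracket j) powr \<sigma> / h j)) < \<infinity>"
  shows "\<exists>C. \<forall>j. ln (1 + jbracket j) powr \<sigma> \<le> C * h j"
proof -
  let ?r = "\<lambda>j. ln (1 + jbracket j) powr \<sigma> / h j"
  have pos: "0 < h j" and even: "h (- j) = h j" for j
    using h by (auto simp: star_weights_def)
  obtain C0 where C0: "Limsup at_top (\<lambda>j. ereal (?r j)) < ereal C0"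
    using lim by (metis ereal_dense2)
  have "\<forall>\<^sub>F j in at_top. ereal (?r j) < ereal C0"
    using C0 by (rule Limsup_lessD)
  then obtain J where J: "\<And>j. J \<le> j \<Longrightarrow> ?r j < C0"
    unfolding eventually_at_top_linorder by auto
  define C where "C = Max (insert C0 (?r ` {0..J}))"
  have "?r j \<le> C" if "0 \<le> j" for j
  proof (cases "J \<le> j")
    case True
    have "C0 \<le> C" by (simp add: C_def)
    with J[OF True] show ?thesis by linarith
  next
    case False
    with that show ?thesis unfolding C_def by (intro Max_ge) auto
  qed
  then have "?r \<bar>j\<bar> \<le> C" for j by simp
  moreover have "?r \<bar>j\<bar> = ?r j" for j
    using even by (simp add: jbracket_def abs_if)
  ultimately have r_le: "?r j \<le> C" for j by metis
  have "ln (1 + jbracket j) powr \<sigma> \<le> C * h j" for j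
    using r_le[of j] pos[of j] by (simp add: pos_divide_le_eq)
  then show ?thesis by blast
qed

section \<open>Logarithms of the Diophantine factors\<close>

lemma star_norm_eq_sum_support:
  assumes "\<nu> \<in> ZZf"
  shows "star_norm h \<nu> = (\<Sum>j | \<nu> j \<noteq> 0. h j * real_of_int \<bar>\<nu> j\<bar>)"
proof -
  have "star_norm h \<nu> = (\<Sum>\<^sub>\<infinity>j\<in>{j. \<nu> j \<noteq> 0}. h j * real_of_int \<bar>\<nu> j\<bar>)"
    unfolding star_norm_def by (rule infsum_cong_neutral) auto
  then show ?thesis
    using assms by (simp add: ZZf_iff_finite_support)
qed

text \<open>The two elementary facts behind this are \<open>1 + x \<le> 2x\<close> for \<open>x \<ge> 1\<close> and
  \<open>2 \<le> (1 + a)\<^bsup>\<mu>\<^sub>1\<^esup>\<close>; the latter is why \<open>\<mu>\<^sub>1\<close> gets doubled.\<close>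

lemma ln_factor_le:
  fixes a b :: real
  assumes a: "1 \<le> a" and b: "1 \<le> b" and \<mu>: "1 \<le> \<mu>\<^sub>1" "0 \<le> \<mu>\<^sub>2"
  shows "ln (1 + a powr \<mu>\<^sub>1 * b powr \<mu>\<^sub>2) \<le> 2 * \<mu>\<^sub>1 * ln (1 + a) + \<mu>\<^sub>2 * ln b"
proof -
  have ge: "1 \<le> a powr \<mu>\<^sub>1" "1 \<le> b powr \<mu>\<^sub>2"
    using assms by (auto intro: ge_one_powr_ge_zero)
  have 1: "1 \<le> a powr \<mu>\<^sub>1 * b powr \<mu>\<^sub>2"
    using mult_mono[OF ge] by simp
  have "ln (1 + a powr \<mu>\<^sub>1 * b powr \<mu>\<^sub>2) \<le> ln (2 * (a powr \<mu>\<^sub>1 * b powr \<mu>\<^sub>2))"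
    using 1 by (subst ln_le_cancel_iff) auto
  also have "\<dots> = ln 2 + \<mu>\<^sub>1 * ln a + \<mu>\<^sub>2 * ln b"
    using a b by (simp add: ln_mult ln_powr)
  also have "ln 2 \<le> \<mu>\<^sub>1 * ln (1 + a)"
    using mult_mono[of 1 \<mu>\<^sub>1 "ln 2" "ln (1 + a)"] a \<mu> by simp
  also have "\<mu>\<^sub>1 * ln a \<le> \<mu>\<^sub>1 * ln (1 + a)"
    using a \<mu> by (intro mult_left_mono) auto
  finally show ?thesis by simp
qed

lemma ln_factor_le_below_cut:
  fixes a :: real and n :: nat
  assumes j: "\<bar>j\<bar> \<le> 2 ^ (m div 2)" and n: "1 \<le> x" "x \<le> 2 ^ m / a"
    and a: "0 < a" and \<mu>: "1 \<le> \<mu>\<^sub>1" "0 \<le> \<mu>\<^sub>2"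
  shows "ln (1 + jbracket j powr \<mu>\<^sub>1 * x powr \<mu>\<^sub>2)
      \<le> (2 * \<mu>\<^sub>1 + \<mu>\<^sub>2 * (1 + \<bar>ln a\<bar>)) * (real m + 1)"
proof -
  have ln2: "ln 2 \<le> (1 :: real)" using ln_le_minus_one[of "2 :: real"] by simp
  have "jbracket j \<le> 2 ^ (m div 2)"
    unfolding jbracket_def using j by (metis max.bounded_iff of_int_le_iff of_int_numeral
        of_int_power one_le_power one_le_numeral)
  also have "\<dots> \<le> 2 ^ m" by (intro power_increasing) auto
  finally have "jbracket j \<le> 2 ^ m" .
  moreover have "(1 :: real) \<le> 2 ^ m" by simp
  ultimately have "1 + jbracket j \<le> 2 ^ (m + 1)"
    unfolding power_add power_one_right by linarith
  then have "ln (1 + jbracket j) \<le> ln (2 ^ (m + 1))"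
    using jbracket_ge_1[of j] by (subst ln_le_cancel_iff) auto
  also have "\<dots> = (real m + 1) * ln 2"
    by (subst ln_realpow) auto
  also have "\<dots> \<le> real m + 1"
    using mult_left_mono[OF ln2, of "real m + 1"] by simp
  finally have L: "ln (1 + jbracket j) \<le> real m + 1" .
  have "ln x \<le> ln (2 ^ m / a)"
    using n a by (subst ln_le_cancel_iff) auto
  also have "\<dots> = real m * ln 2 - ln a"
    using a by (simp add: ln_div ln_realpow)
  also have "\<dots> \<le> (1 + \<bar>ln a\<bar>) * (real m + 1)"
  proof -
    have "real m * ln 2 \<le> real m" using mult_left_mono[OF ln2, of "real m"] by simp
    moreover have "0 \<le> \<bar>ln a\<bar> * real m" by simp
    moreover have "- ln a \<le> \<bar>ln a\<bar>" by simp
    ultimately show ?thesis unfolding distrib_left distrib_right mult_1 mult_1_right by linarith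
  qed
  finally have x: "ln x \<le> (1 + \<bar>ln a\<bar>) * (real m + 1)" .
  have "ln (1 + jbracket j powr \<mu>\<^sub>1 * x powr \<mu>\<^sub>2) \<le> 2 * \<mu>\<^sub>1 * ln (1 + jbracket j) + \<mu>\<^sub>2 * ln x"
    using n \<mu> jbracket_ge_1 by (intro ln_factor_le) auto
  also have "\<dots> \<le> 2 * \<mu>\<^sub>1 * (real m + 1) + \<mu>\<^sub>2 * ((1 + \<bar>ln a\<bar>) * (real m + 1))"
    using L x \<mu> by (intro add_mono mult_left_mono) auto
  finally show ?thesis by (simp add: algebra_simps)
qed

text \<open>Above the cut \<open>L = ln (1 + \<langle>j\<rangle>)\<close> is at least \<open>(m + 1) ln 2 / 4\<close>; writing
  \<open>L = L\<^bsup>1-\<sigma>\<^esup> L\<^bsup>\<sigma>\<^esup>\<close>, the first factor is small and the second is controlled by the weight.\<close>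

lemma ln_factor_le_above_cut:
  fixes H x :: real
  assumes j: "2 ^ (m div 2) < \<bar>j\<bar>" and x: "1 \<le> x"
    and H: "ln (1 + jbracket j) powr \<sigma> \<le> C * H"
    and \<sigma>: "1 \<le> \<sigma>" and \<mu>: "1 \<le> \<mu>\<^sub>1" "0 \<le> \<mu>\<^sub>2"
  shows "ln (1 + jbracket j powr \<mu>\<^sub>1 * x powr \<mu>\<^sub>2)
      \<le> (2 * \<mu>\<^sub>1 + 2 * \<mu>\<^sub>2) * C * (ln 2 / 4) powr (1 - \<sigma>) * (real m + 1) powr (1 - \<sigma>) * (H * x)"
proof -
  define L where "L = ln (1 + jbracket j)"
  define l where "l = ln 2 / 4 * (real m + 1)"
  have l_pos: "0 < l" by (simp add: l_def)
  have "ln 2 \<le> L"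
    unfolding L_def using jbracket_ge_1[of j] by (subst ln_le_cancel_iff) auto
  moreover have "real (m div 2) * ln 2 \<le> L"
  proof -
    have "real_of_int (2 ^ (m div 2)) \<le> jbracket j"
      unfolding jbracket_def of_int_le_iff using j by linarith
    then have "ln (2 ^ (m div 2)) \<le> L"
      unfolding L_def using jbracket_ge_1[of j] by (subst ln_le_cancel_iff) auto
    then show ?thesis by (simp add: ln_realpow)
  qed
  \<comment> \<open>The average of the two bounds is linear in \<open>m\<close> and also positive for small \<open>m\<close>.\<close>
  ultimately have "(real (m div 2) + 1) / 2 * ln 2 \<le> L" by (simp add: field_simps)
  moreover have "(real m + 1) / 4 \<le> (real (m div 2) + 1) / 2"
  proof -
    have "m \<le> 2 * (m div 2) + 1" by presburger
    then have "real m \<le> real (2 * (m div 2) + 1)" by (rule of_nat_mono)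
    then show ?thesis by simp
  qed
  then have "(real m + 1) / 4 * ln 2 \<le> (real (m div 2) + 1) / 2 * ln 2"
    by (rule mult_right_mono) simp
  ultimately have l: "l \<le> L" by (simp add: l_def field_simps)
  have half: "1 / 2 \<le> ln (2 :: real)"
    using ln_le_minus_one[of "1 / 2 :: real"] by (simp add: ln_div)
  have L: "1 \<le> 2 * L" "0 < L" using half \<open>ln 2 \<le> L\<close> by linarith+
  have "L = L powr (1 - \<sigma>) * L powr \<sigma>"
    using L by (simp flip: powr_add)
  also have "\<dots> \<le> l powr (1 - \<sigma>) * (C * H)"
    using H l l_pos \<sigma> by (intro mult_mono powr_mono2') (auto simp: L_def)
  finally have LH: "L \<le> l powr (1 - \<sigma>) * (C * H)" .
  have "ln (1 + jbracket j powr \<mu>\<^sub>1 * x powr \<mu>\<^sub>2) \<le> 2 * \<mu>\<^sub>1 * L + \<mu>\<^sub>2 * ln x"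
    unfolding L_def using x \<mu> jbracket_ge_1 by (intro ln_factor_le) auto
  also have "\<dots> \<le> 2 * \<mu>\<^sub>1 * (L * x) + \<mu>\<^sub>2 * (2 * (L * x))"
  proof (intro add_mono mult_left_mono)
    show "L \<le> L * x" using L x by simp
    have "ln x \<le> x" using x ln_le_minus_one[of x] by simp
    also have "\<dots> \<le> 2 * L * x" using mult_right_mono[OF L(1), of x] x by simp
    finally show "ln x \<le> 2 * (L * x)" by simp
  qed (use \<mu> in simp_all)
  also have "\<dots> = (2 * \<mu>\<^sub>1 + 2 * \<mu>\<^sub>2) * (L * x)" by (simp add: algebra_simps)
  also have "\<dots> \<le> (2 * \<mu>\<^sub>1 + 2 * \<mu>\<^sub>2) * (l powr (1 - \<sigma>) * (C * H) * x)"
    using LH \<mu> x by (intro mult_left_mono mult_right_mono) auto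
  also have "l powr (1 - \<sigma>) = (ln 2 / 4) powr (1 - \<sigma>) * (real m + 1) powr (1 - \<sigma>)"
    unfolding l_def by (rule powr_mult)
  finally show ?thesis by (simp add: mult_ac)
qed

definition log_bound :: "real \<Rightarrow> real \<Rightarrow> real \<Rightarrow> nat \<Rightarrow> real" where
  "log_bound A B \<sigma> m =
     A * (real m + 1) * 2 ^ (m div 2) + B * (real m + 1) powr (1 - \<sigma>) * 2 ^ m"

text \<open>The central estimate.  The factor \<open>3\<close> comes from
  \<open>card {j. \<bar>j\<bar> \<le> K} = 2K + 1 \<le> 3K\<close>.\<close>

lemma sum_log_factors_le:
  assumes h: "star_weights h" and dom: "\<And>j. ln (1 + jbracket j) powr \<sigma> \<le> C * h j"
    and \<nu>: "\<nu> \<in> ZZf" "star_norm h \<nu> \<le> 2 ^ m"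
    and \<sigma>: "1 \<le> \<sigma>" and \<mu>: "1 \<le> \<mu>\<^sub>1" "0 \<le> \<mu>\<^sub>2"
  shows "(\<Sum>j | \<nu> j \<noteq> 0. ln (1 + jbracket j powr \<mu>\<^sub>1 * real_of_int \<bar>\<nu> j\<bar> powr \<mu>\<^sub>2))
    \<le> log_bound (3 * (2 * \<mu>\<^sub>1 + \<mu>\<^sub>2 * (1 + \<bar>ln (h 0)\<bar>)))
        ((2 * \<mu>\<^sub>1 + 2 * \<mu>\<^sub>2) * C * (ln 2 / 4) powr (1 - \<sigma>)) \<sigma> m"
proof -
  define S where "S = {j. \<nu> j \<noteq> 0}"
  define K :: int where "K = 2 ^ (m div 2)"
  let ?f = "\<lambda>j. ln (1 + jbracket j powr \<mu>\<^sub>1 * real_of_int \<bar>\<nu> j\<bar> powr \<mu>\<^sub>2)"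
  let ?g = "\<lambda>j. h j * real_of_int \<bar>\<nu> j\<bar>"
  define T where "T = (2 * \<mu>\<^sub>1 + \<mu>\<^sub>2 * (1 + \<bar>ln (h 0)\<bar>)) * (real m + 1)"
  define R where "R = (2 * \<mu>\<^sub>1 + 2 * \<mu>\<^sub>2) * C * (ln 2 / 4) powr (1 - \<sigma>) * (real m + 1) powr (1 - \<sigma>)"
  have pos: "0 < h j" for j using h by (simp add: star_weights_def)
  have fin: "finite S" using \<nu> by (simp add: S_def ZZf_iff_finite_support)
  have total: "(\<Sum>j\<in>S. ?g j) \<le> 2 ^ m"
    using \<nu> star_norm_eq_sum_support[of \<nu> h] by (simp add: S_def)
  have g_nonneg: "0 \<le> ?g j" for j using pos[of j] by simp
  have ge1: "1 \<le> real_of_int \<bar>\<nu> j\<bar>" if "j \<in> S" for j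
    using that by (simp add: S_def flip: of_int_abs)
  have C: "0 \<le> C * h 0" using dom[of 0] by (meson order_trans powr_ge_zero)
  then have "0 \<le> C" using pos[of 0] by (simp add: zero_le_mult_iff)
  have R: "0 \<le> R" using \<mu> \<open>0 \<le> C\<close> by (simp add: R_def)
  have T: "0 \<le> T" using \<mu> by (simp add: T_def)
  have "(\<Sum>j\<in>S. ?f j) = (\<Sum>j\<in>S \<inter> {j. \<bar>j\<bar> \<le> K}. ?f j) + (\<Sum>j\<in>S - {j. \<bar>j\<bar> \<le> K}. ?f j)"
    using fin by (rule sum.Int_Diff)
  also have "(\<Sum>j\<in>S \<inter> {j. \<bar>j\<bar> \<le> K}. ?f j) \<le> T * (3 * 2 ^ (m div 2))"
  proof -
    have "?f j \<le> T" if j: "j \<in> S \<inter> {j. \<bar>j\<bar> \<le> K}" for j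
    proof -
      have "h 0 * real_of_int \<bar>\<nu> j\<bar> \<le> ?g j"
        by (rule mult_right_mono[OF star_weights_ge_0[OF h]]) simp
      also have "\<dots> \<le> (\<Sum>j\<in>S. ?g j)"
        using j fin g_nonneg by (intro member_le_sum) auto
      also note total
      finally have "real_of_int \<bar>\<nu> j\<bar> \<le> 2 ^ m / h 0"
        using pos[of 0] by (simp add: field_simps)
      then show ?thesis
        unfolding T_def using j ge1 pos[of 0] \<mu>
        by (intro ln_factor_le_below_cut) (auto simp: K_def)
    qed
    then have "(\<Sum>j\<in>S \<inter> {j. \<bar>j\<bar> \<le> K}. ?f j) \<le> real (card (S \<inter> {j. \<bar>j\<bar> \<le> K})) * T"
      by (rule sum_bounded_above)
    also have "\<dots> \<le> (3 * 2 ^ (m div 2)) * T"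
    proof (rule mult_right_mono[OF _ T])
      have "card (S \<inter> {j. \<bar>j\<bar> \<le> K}) \<le> card {- K..K}"
        by (rule card_mono) auto
      also have "\<dots> = nat (2 * K + 1)" by simp
      finally have "real (card (S \<inter> {j. \<bar>j\<bar> \<le> K})) \<le> real (nat (2 * K + 1))"
        by (rule of_nat_mono)
      also have "1 \<le> K" by (simp add: K_def)
      then have "real (nat (2 * K + 1)) \<le> 3 * real_of_int K" by simp
      finally show "real (card (S \<inter> {j. \<bar>j\<bar> \<le> K})) \<le> 3 * 2 ^ (m div 2)"
        by (simp add: K_def)
    qed
    finally show ?thesis by (simp add: mult.commute)
  qed
  also have "(\<Sum>j\<in>S - {j. \<bar>j\<bar> \<le> K}. ?f j) \<le> R * 2 ^ m"
  proof -
    have "(\<Sum>j\<in>S - {j. \<bar>j\<bar> \<le> K}. ?f j) \<le> (\<Sum>j\<in>S - {j. \<bar>j\<bar> \<le> K}. R * ?g j)"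
      unfolding R_def using ge1 dom \<sigma> \<mu>
      by (intro sum_mono ln_factor_le_above_cut) (auto simp: K_def)
    also have "\<dots> \<le> (\<Sum>j\<in>S. R * ?g j)"
      using fin R g_nonneg by (intro sum_mono2) auto
    also have "\<dots> \<le> R * 2 ^ m"
      using mult_left_mono[OF total R] by (simp add: sum_distrib_left)
    finally show ?thesis .
  qed
  finally show ?thesis
    by (simp add: S_def T_def R_def log_bound_def algebra_simps)
qed

lemma summable_log_bound:
  assumes "2 < \<sigma>"
  shows "summable (\<lambda>m. 1 / 2 ^ Suc m * log_bound A B \<sigma> (Suc m))"
proof -
  have "summable (\<lambda>m. (real m + 1) * 2 ^ (m div 2) / 2 ^ m)"
  proof (rule summable_comparison_test')
    have "(\<lambda>m. (real m + 1) * 2 powr (- real m / 2)) \<in> O(\<lambda>m. 1 / real m ^ 2)"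
      by real_asymp
    then show "summable (\<lambda>m. (real m + 1) * 2 powr (- real m / 2))"
      by (rule summable_comparison_test_bigo[rotated])
         (use inverse_power_summable[of 2, where 'a = real] in \<open>simp add: field_simps\<close>)
    fix m :: nat
    have "(2 :: real) ^ (m div 2) / 2 ^ m = 2 powr (real (m div 2) - real m)"
      by (simp add: powr_diff powr_realpow)
    also have "\<dots> \<le> 2 powr (- real m / 2)"
      by (intro powr_mono) linarith+
    finally have "(real m + 1) * (2 ^ (m div 2) / 2 ^ m) \<le> (real m + 1) * 2 powr (- real m / 2)"
      by (intro mult_left_mono) auto
    then show "norm ((real m + 1) * 2 ^ (m div 2) / 2 ^ m) \<le> (real m + 1) * 2 powr (- real m / 2)"
      by simp
  qed
  moreover have "summable (\<lambda>m. (real m + 1) powr (1 - \<sigma>))"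
  proof -
    have "summable (\<lambda>m. real m powr (1 - \<sigma>))"
      using assms by (simp add: summable_real_powr_iff)
    then show ?thesis
      by (subst (asm) summable_Suc_iff[symmetric]) (simp add: add.commute)
  qed
  ultimately have "summable (\<lambda>m. A * ((real m + 1) * 2 ^ (m div 2) / 2 ^ m)
      + B * (real m + 1) powr (1 - \<sigma>))"
    by (intro summable_add summable_mult)
  also have "(\<lambda>m. A * ((real m + 1) * 2 ^ (m div 2) / 2 ^ m) + B * (real m + 1) powr (1 - \<sigma>))
      = (\<lambda>m. 1 / 2 ^ m * log_bound A B \<sigma> m)"
    by (simp add: log_bound_def fun_eq_iff field_simps)
  finally show ?thesis
    by (subst summable_Suc_iff)
qed

section \<open>Lower bounds for the small divisors\<close>

text \<open>The minimum with \<open>1\<close> keeps this lower bound below \<open>1\<close>, as \<open>log_recip_le\<close> below requires.\<close>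

lemma Dioph_beta_star_ge:
  assumes h: "star_weights h" and dom: "\<And>j. ln (1 + jbracket j) powr \<sigma> \<le> C * h j"
    and \<sigma>: "1 \<le> \<sigma>" and \<mu>: "1 \<le> \<mu>\<^sub>1" "0 \<le> \<mu>\<^sub>2" and \<gamma>: "0 < \<gamma>"
    and \<omega>: "\<omega> \<in> Dioph \<gamma> \<mu>\<^sub>1 \<mu>\<^sub>2"
  shows "ereal (min 1 \<gamma> * exp (- log_bound (3 * (2 * \<mu>\<^sub>1 + \<mu>\<^sub>2 * (1 + \<bar>ln (h 0)\<bar>)))
      ((2 * \<mu>\<^sub>1 + 2 * \<mu>\<^sub>2) * C * (ln 2 / 4) powr (1 - \<sigma>)) \<sigma> m)) \<le> beta_star h \<omega> m"
    (is "ereal (_ * exp (- ?F)) \<le> _")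
  unfolding beta_star_def
proof (rule INF_greatest)
  fix \<nu> assume "\<nu> \<in> {\<nu> \<in> ZZf. 0 < star_norm h \<nu> \<and> star_norm h \<nu> \<le> 2 ^ m}"
  then have \<nu>: "\<nu> \<in> ZZf" "0 < star_norm h \<nu>" "star_norm h \<nu> \<le> 2 ^ m" by auto
  let ?p = "\<lambda>j. 1 + jbracket j powr \<mu>\<^sub>1 * real_of_int \<bar>\<nu> j\<bar> powr \<mu>\<^sub>2"
  have p: "0 < ?p j" for j by (intro add_pos_nonneg) auto
  have "\<nu> \<noteq> (\<lambda>_. 0)" using \<nu>(2) by (auto simp: star_norm_def)
  then have "\<gamma> * (\<Prod>j | \<nu> j \<noteq> 0. inverse (?p j)) \<le> \<bar>dotZ \<omega> \<nu>\<bar>"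
    using \<omega> \<nu>(1) by (simp add: Dioph_def)
  moreover have "(\<Prod>j | \<nu> j \<noteq> 0. inverse (?p j)) = exp (- (\<Sum>j | \<nu> j \<noteq> 0. ln (?p j)))"
    using \<nu>(1) p by (simp add: ZZf_iff_finite_support exp_sum exp_minus flip: sum_negf)
  moreover have "min 1 \<gamma> * exp (- ?F) \<le> \<gamma> * exp (- (\<Sum>j | \<nu> j \<noteq> 0. ln (?p j)))"
    using sum_log_factors_le[OF h dom \<nu>(1,3) \<sigma> \<mu>] \<gamma> by (intro mult_mono) auto
  ultimately show "ereal (min 1 \<gamma> * exp (- ?F)) \<le> ereal \<bar>dotZ \<omega> \<nu>\<bar>"
    by (simp del: of_int_abs)
qed

text \<open>The hypothesis \<open>b \<le> 1\<close> takes care of \<open>x = \<infinity>\<close>, where \<open>log_recip\<close> is \<open>0\<close> by convention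
  instead of \<open>-\<infinity>\<close>.\<close>

lemma log_recip_le:
  assumes "0 < b" "b \<le> 1" "ereal b \<le> x"
  shows "log_recip x \<le> ereal (ln (1 / b))"
proof (cases x)
  case (real r)
  with assms have "0 < r" "b \<le> r" by auto
  then have "ln (1 / r) \<le> ln (1 / b)"
    using assms by (subst ln_le_cancel_iff) (auto simp: field_simps)
  with real \<open>0 < r\<close> show ?thesis by (simp add: log_recip_def)
qed (use assms in \<open>auto simp: log_recip_def\<close>)

lemma bryuno_le:
  assumes "\<And>m. 0 < \<beta> (Suc m)" "\<And>m. \<beta> (Suc m) \<le> 1"
    and "\<And>m. ereal (\<beta> (Suc m)) \<le> beta_star h \<omega> (Suc m)"
    and "summable (\<lambda>m. 1 / 2 ^ Suc m * ln (1 / \<beta> (Suc m)))"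
  shows "bryuno h \<omega> \<le> ereal (\<Sum>m. 1 / 2 ^ Suc m * ln (1 / \<beta> (Suc m)))"
proof (rule sums_le[OF _ bryuno_sums])
  show "(\<lambda>m. ereal (1 / 2 ^ Suc m * ln (1 / \<beta> (Suc m)))) sums
      ereal (\<Sum>m. 1 / 2 ^ Suc m * ln (1 / \<beta> (Suc m)))"
    unfolding sums_ereal using assms(4) by (rule summable_sums)
  fix m
  have "ereal (1 / 2 ^ Suc m) * log_recip (beta_star h \<omega> (Suc m))
      \<le> ereal (1 / 2 ^ Suc m) * ereal (ln (1 / \<beta> (Suc m)))"
    using assms by (intro ereal_mult_left_mono log_recip_le) auto
  then show "ereal (1 / 2 ^ Suc m) * log_recip (beta_star h \<omega> (Suc m))
      \<le> ereal (1 / 2 ^ Suc m * ln (1 / \<beta> (Suc m)))"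
    by simp
qed

section \<open>Uniform Bryuno bounds on Diophantine sets\<close>

theorem proposition2p11:
  fixes h :: "int \<Rightarrow> real"
  assumes "star_weights h"
  shows "\<exists>\<beta>\<^sub>s :: real \<Rightarrow> real \<Rightarrow> real \<Rightarrow> real \<Rightarrow> nat \<Rightarrow> real.
    \<forall>q \<gamma> \<sigma> \<mu>\<^sub>1 \<mu>\<^sub>2 :: real.
      q > 1 / 2 \<longrightarrow> \<gamma> > 0 \<longrightarrow> \<sigma> > 2 \<longrightarrow>
      Limsup at_top (\<lambda>j. ereal (ln (1 + jbracket j) powr \<sigma> / h j)) < \<infinity> \<longrightarrow>
      \<mu>\<^sub>1 > 1 + q \<longrightarrow> \<mu>\<^sub>2 > 1 \<longrightarrow>
        Dioph \<gamma> \<mu>\<^sub>1 \<mu>\<^sub>2 \<subseteq> Bryuno_set h \<and>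
        (\<forall>m. \<beta>\<^sub>s \<gamma> \<mu>\<^sub>1 \<mu>\<^sub>2 \<sigma> m > 0) \<and>
        (\<forall>\<omega> \<in> Dioph \<gamma> \<mu>\<^sub>1 \<mu>\<^sub>2. \<forall>m. beta_star h \<omega> m \<ge> ereal (\<beta>\<^sub>s \<gamma> \<mu>\<^sub>1 \<mu>\<^sub>2 \<sigma> m)) \<and>
        summable (\<lambda>m. 1 / 2 ^ Suc m * ln (1 / \<beta>\<^sub>s \<gamma> \<mu>\<^sub>1 \<mu>\<^sub>2 \<sigma> (Suc m))) \<and>
        (\<forall>\<omega> \<in> Dioph \<gamma> \<mu>\<^sub>1 \<mu>\<^sub>2.
           bryuno h \<omega> \<le> ereal (\<Sum>m. 1 / 2 ^ Suc m * ln (1 / \<beta>\<^sub>s \<gamma> \<mu>\<^sub>1 \<mu>\<^sub>2 \<sigma> (Suc m)))) \<and>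
        (\<forall>\<beta> :: nat \<Rightarrow> real.
           (\<forall>m. \<beta> m > 0) \<longrightarrow>
           (\<forall>m\<ge>1. \<beta> m \<le> \<beta>\<^sub>s \<gamma> \<mu>\<^sub>1 \<mu>\<^sub>2 \<sigma> m) \<longrightarrow>
           summable (\<lambda>m. 1 / 2 ^ Suc m * ln (1 / \<beta> (Suc m))) \<longrightarrow>
           (\<exists>D. D \<subseteq> Bryuno_set h \<and> Dioph \<gamma> \<mu>\<^sub>1 \<mu>\<^sub>2 \<subseteq> D \<and>
              (\<forall>\<omega> \<in> D. bryuno h \<omega> \<le> ereal (\<Sum>m. 1 / 2 ^ Suc m * ln (1 / \<beta> (Suc m))))))"
proof -
  \<comment> \<open>The limsup hypothesis stands under the quantifier over \<open>\<sigma>\<close>, hence a constant is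
    chosen for every \<open>\<sigma>\<close>; it is meaningful only where one exists.\<close>
  define C where
    "C \<sigma> = (SOME C. \<forall>j. ln (1 + jbracket j) powr \<sigma> \<le> C * h j)" for \<sigma> :: real
  define F where
    "F \<mu>\<^sub>1 \<mu>\<^sub>2 \<sigma> = log_bound (3 * (2 * \<mu>\<^sub>1 + \<mu>\<^sub>2 * (1 + \<bar>ln (h 0)\<bar>)))
       ((2 * \<mu>\<^sub>1 + 2 * \<mu>\<^sub>2) * C \<sigma> * (ln 2 / 4) powr (1 - \<sigma>)) \<sigma>" for \<mu>\<^sub>1 \<mu>\<^sub>2 \<sigma> :: real
  define bs where "bs \<gamma> \<mu>\<^sub>1 \<mu>\<^sub>2 \<sigma> m = min 1 \<gamma> * exp (- F \<mu>\<^sub>1 \<mu>\<^sub>2 \<sigma> m)"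
    for \<gamma> \<mu>\<^sub>1 \<mu>\<^sub>2 \<sigma> :: real and m :: nat
  show ?thesis
  proof (intro exI[of _ bs] allI impI)
    fix q \<gamma> \<sigma> \<mu>\<^sub>1 \<mu>\<^sub>2 :: real
    assume q: "1 / 2 < q" and \<gamma>: "0 < \<gamma>" and \<sigma>: "2 < \<sigma>"
      and lim: "Limsup at_top (\<lambda>j. ereal (ln (1 + jbracket j) powr \<sigma> / h j)) < \<infinity>"
      and \<mu>1: "1 + q < \<mu>\<^sub>1" and \<mu>2: "1 < \<mu>\<^sub>2"
    let ?D = "Dioph \<gamma> \<mu>\<^sub>1 \<mu>\<^sub>2" and ?b = "bs \<gamma> \<mu>\<^sub>1 \<mu>\<^sub>2 \<sigma>"
    let ?B = "\<lambda>\<beta>. \<Sum>m. 1 / 2 ^ Suc m * ln (1 / \<beta> (Suc m))"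
    let ?conv = "\<lambda>\<beta>. summable (\<lambda>m. 1 / 2 ^ Suc m * ln (1 / \<beta> (Suc m)))"
    have dom: "ln (1 + jbracket j) powr \<sigma> \<le> C \<sigma> * h j" for j
      using someI_ex[OF weights_dominate_log[OF assms lim]] unfolding C_def by blast
    have C: "0 \<le> C \<sigma>"
    proof -
      have "0 \<le> C \<sigma> * h 0" using dom[of 0] by (meson order_trans powr_ge_zero)
      moreover have "0 < h 0" using assms by (simp add: star_weights_def)
      ultimately show ?thesis by (simp add: zero_le_mult_iff)
    qed
    have F: "0 \<le> F \<mu>\<^sub>1 \<mu>\<^sub>2 \<sigma> m" for m
      unfolding F_def log_bound_def using C q \<mu>1 \<mu>2
      by (intro add_nonneg_nonneg mult_nonneg_nonneg) auto
    have pos: "0 < ?b m" for m using \<gamma> by (simp add: bs_def)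
    have le1: "?b m \<le> 1" for m
      unfolding bs_def using F[of m] \<gamma> by (intro mult_le_one) auto
    have lower: "ereal (?b m) \<le> beta_star h \<omega> m" if "\<omega> \<in> ?D" for \<omega> m
      unfolding bs_def F_def using assms dom \<sigma> q \<mu>1 \<mu>2 \<gamma> that
      by (intro Dioph_beta_star_ge) auto
    have conv: "?conv ?b"
    proof -
      have "summable (\<lambda>m. - ln (min 1 \<gamma>) * (1 / 2 ^ Suc m) + 1 / 2 ^ Suc m * F \<mu>\<^sub>1 \<mu>\<^sub>2 \<sigma> (Suc m))"
        unfolding F_def using power_half_series
        by (intro summable_add summable_mult summable_log_bound \<sigma>)
           (simp add: sums_iff power_divide)
      also have "(\<lambda>m. - ln (min 1 \<gamma>) * (1 / 2 ^ Suc m) + 1 / 2 ^ Suc m * F \<mu>\<^sub>1 \<mu>\<^sub>2 \<sigma> (Suc m))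
          = (\<lambda>m. 1 / 2 ^ Suc m * ln (1 / ?b (Suc m)))"
      proof
        fix m
        have "ln (1 / ?b (Suc m)) = - ln (min 1 \<gamma>) + F \<mu>\<^sub>1 \<mu>\<^sub>2 \<sigma> (Suc m)"
          using pos[of "Suc m"] \<gamma> by (simp add: bs_def ln_div ln_mult)
        then show "- ln (min 1 \<gamma>) * (1 / 2 ^ Suc m) + 1 / 2 ^ Suc m * F \<mu>\<^sub>1 \<mu>\<^sub>2 \<sigma> (Suc m)
            = 1 / 2 ^ Suc m * ln (1 / ?b (Suc m))"
          by (simp only:) (simp add: field_simps)
      qed
      finally show ?thesis .
    qed
    \<comment> \<open>Stated for every admissible \<open>\<beta>\<close>: the case \<open>\<beta> = \<beta>\<^sub>*\<close> is the uniform bound, and the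
      general case shows that the Diophantine set is a witness for the last claim.\<close>
    have bound: "bryuno h \<omega> \<le> ereal (?B \<beta>)"
      if "\<omega> \<in> ?D" "\<forall>m. 0 < \<beta> m" "\<forall>m\<ge>1. \<beta> m \<le> ?b m" "?conv \<beta>" for \<omega> \<beta>
    proof (rule bryuno_le)
      fix m
      have "\<beta> (Suc m) \<le> ?b (Suc m)" using that by simp
      then show "\<beta> (Suc m) \<le> 1" "ereal (\<beta> (Suc m)) \<le> beta_star h \<omega> (Suc m)"
        using le1[of "Suc m"] lower[OF that(1), of "Suc m"]
        by (auto intro: order_trans simp flip: ereal_less_eq(3))
    qed (use that in auto)
    have bound_b: "bryuno h \<omega> \<le> ereal (?B ?b)" if "\<omega> \<in> ?D" for \<omega>
      using that pos conv by (intro bound) auto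
    have sub: "?D \<subseteq> Bryuno_set h"
    proof
      fix \<omega> assume "\<omega> \<in> ?D"
      from bound_b[OF this] have "bryuno h \<omega> < \<infinity>"
        by (rule le_less_trans) simp
      then show "\<omega> \<in> Bryuno_set h" by (simp add: Bryuno_set_def)
    qed
    have "\<exists>D. D \<subseteq> Bryuno_set h \<and> ?D \<subseteq> D \<and> (\<forall>\<omega>\<in>D. bryuno h \<omega> \<le> ereal (?B \<beta>))"
      if "\<forall>m. 0 < \<beta> m" "\<forall>m\<ge>1. \<beta> m \<le> ?b m" "?conv \<beta>" for \<beta>
      using sub bound that by blast
    then show "?D \<subseteq> Bryuno_set h \<and> (\<forall>m. 0 < ?b m)
        \<and> (\<forall>\<omega>\<in>?D. \<forall>m. ereal (?b m) \<le> beta_star h \<omega> m) \<and> ?conv ?b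
        \<and> (\<forall>\<omega>\<in>?D. bryuno h \<omega> \<le> ereal (?B ?b))
        \<and> (\<forall>\<beta>. (\<forall>m. 0 < \<beta> m) \<longrightarrow> (\<forall>m\<ge>1. \<beta> m \<le> ?b m) \<longrightarrow> ?conv \<beta> \<longrightarrow>
             (\<exists>D. D \<subseteq> Bryuno_set h \<and> ?D \<subseteq> D \<and> (\<forall>\<omega>\<in>D. bryuno h \<omega> \<le> ereal (?B \<beta>))))"
      using sub pos lower conv bound_b by blast
  qed
qed

end
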